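(* For every atomic system $S$ and every formula of the form $A^c$ where $A$ is not atomic (i.e. $A^c=(B\circ C)^c$ for some connective $\circ\in\{\wedge,\vee,\to\}$ and $A^i=(B\circ C)^i$), $A^i\Vdash^L_S A^c$.
   Context: Basic setting. Let $\mathsf{At}$ be a countably infinite set of atomic propositions and $\mathsf{At}_\bot=\mathsf{At}\cup\{\bot\}$. An atomic rule has the form "from premises $p_1,\dots,p_n$ ($n\ge 0$) infer $p$", with $p_j,p\in\mathsf{At}_\bot$, where the derivation of each premise may discharge a set of basic sentences. An atomic system $S$ is a set of atomic rules; $S\subseteq S'$ ($S'$ extends $S$) if $S'$ contains all rules of $S$. $\Delta\vdash_S p$ means there is a natural-deduction derivation using only rules of $S$ with conclusion $p$ and undischarged assumptions in $\Delta$ (so $p\vdash_S p$). $S$ is consistent if $\nvdash_S\bot$. Standing convention: all atomic systems (including all extensions quantified over) are required to be consistent. Ecumenical formulas: $p^i,p^c$ for $p\in\mathsf{At}_\bot$; $(A\wedge B)^x,(A\vee B)^x,(A\to B)^x$ for $x\in\{i,c\}$. $A\wedge B$, $A\vee B$, $A\to B$ abbreviate the $i$-versions, $\bot$ denotes $\bot^i$, $\neg A:=(A\to\bot^i)^i$; for $X^c$, $X^i$ is the same construction with outer superscript $i$. Weak validity (by simultaneous recursion): (1) $\Vdash^L_S p^i$ iff $\vdash_S p$ ($p\in\mathsf{At}_\bot$); (2) $\Vdash^L_S p^c$ iff $p\nvdash_S\bot$; (3) for non-atomic $X$, $\Vdash^L_S X^c$ iff $X^i\nVdash^L_S\bot$;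 (4) $\Vdash^L_S(A\wedge B)^i$ iff $\Vdash^L_S A$ and $\Vdash^L_S B$; (5) $\Vdash^L_S(A\to B)^i$ iff $A\Vdash^G_S B$; (6) $\Vdash^L_S(A\vee B)^i$ iff for all $S'\supseteq S$ and all $p\in\mathsf{At}_\bot$, if $A\Vdash^L_{S'}p^i$ and $B\Vdash^L_{S'}p^i$ then $\Vdash^L_{S'}p^i$; (7) for nonempty $\Gamma$, $\Gamma\Vdash^L_S A$ iff for all $S'\supseteq S$, if $\Vdash^L_{S'}B$ for all $B\in\Gamma$ then $\Vdash^L_{S'}A$; (8) $\Gamma\Vdash^G_S A$ iff for all $S'\supseteq S$: if $\Vdash^L_{S''}B$ for all $B\in\Gamma$ and all $S''\supseteq S'$, then $\Vdash^L_{S''}A$ for all $S''\supseteq S'$; (9) $\Gamma\Vdash A$ iff $\Gamma\Vdash^G_S A$ for all $S$. *)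

theory Defs
  imports "HOL-Library.Countable" "HOL-Library.Infinite_Typeclass"
begin

section \<open>Atomic systems\<close>

text \<open>The type \<open>'a\<close> is the set of atomic propositions; the theorem takes it countably infinite.\<close>

datatype 'a basic = At 'a | Falsum

text \<open>Each premise is paired with the set of basic sentences its derivation may discharge.\<close>

datatype 'a atomic_rule = Rule "('a basic set \<times> 'a basic) list" "'a basic"

type_synonym 'a atomic_system = "'a atomic_rule set"

inductive derives :: "'a atomic_system \<Rightarrow> 'a basic set \<Rightarrow> 'a basic \<Rightarrow> bool"
  for S :: "'a atomic_system" where
  assumption: "p \<in> \<Delta> \<Longrightarrow> derives S \<Delta> p"
| rule: "Rule ps c \<in> S \<Longrightarrow> (\<And>\<Gamma> p. (\<Gamma>, p) \<in> set ps \<Longrightarrow> derives S (\<Delta> \<union> \<Gamma>) p) \<Longrightarrow> derives S \<Delta> c"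

definition consistent :: "'a atomic_system \<Rightarrow> bool" where
  "consistent S \<longleftrightarrow> \<not> derives S {} Falsum"

text \<open>Only consistent systems count as extensions.\<close>

definition extends :: "'a atomic_system \<Rightarrow> 'a atomic_system \<Rightarrow> bool" where
  "extends S' S \<longleftrightarrow> S \<subseteq> S' \<and> consistent S'"

section \<open>Ecumenical formulas\<close>

datatype mode = Intu | Clas

datatype conn = Conj | Disj | Imp

datatype 'a form =
    Atomic "'a basic" mode
  | Compound conn "'a form" "'a form" mode

section \<open>Weak validity\<close>

fun weight :: "'a form \<Rightarrow> nat" where
  "weight (Atomic p Intu) = 0"
| "weight (Atomic p Clas) = 1"
| "weight (Compound k A B Intu) = weight A + weight B + 1"
| "weight (Compound k A B Clas) = weight A + weight B + 2"

text \<open>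
  The consequence relations are written out inside the recursion; the lemmas below restate the
  clauses in terms of them.
\<close>

function valid :: "'a atomic_system \<Rightarrow> 'a form \<Rightarrow> bool" where
  "valid S (Atomic p Intu) \<longleftrightarrow> derives S {} p"
| "valid S (Atomic p Clas) \<longleftrightarrow> \<not> derives S {p} Falsum"
| "valid S (Compound k A B Clas) \<longleftrightarrow>
     \<not> (\<forall>S'. extends S' S \<longrightarrow> valid S' (Compound k A B Intu) \<longrightarrow> valid S' (Atomic Falsum Intu))"
| "valid S (Compound Conj A B Intu) \<longleftrightarrow> valid S A \<and> valid S B"
| "valid S (Compound Imp A B Intu) \<longleftrightarrow>
     (\<forall>S'. extends S' S \<longrightarrow>
        (\<forall>S''. extends S'' S' \<longrightarrow> valid S'' A) \<longrightarrow>
        (\<forall>S''. extends S'' S' \<longrightarrow> valid S'' B))"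
| "valid S (Compound Disj A B Intu) \<longleftrightarrow>
     (\<forall>S' p. extends S' S \<longrightarrow>
        (\<forall>S''. extends S'' S' \<longrightarrow> valid S'' A \<longrightarrow> valid S'' (Atomic p Intu)) \<longrightarrow>
        (\<forall>S''. extends S'' S' \<longrightarrow> valid S'' B \<longrightarrow> valid S'' (Atomic p Intu)) \<longrightarrow>
        valid S' (Atomic p Intu))"
  by pat_completeness auto
termination
  by (relation "measure (\<lambda>(S, A). weight A)") auto

definition local_consequence :: "'a atomic_system \<Rightarrow> 'a form set \<Rightarrow> 'a form \<Rightarrow> bool" where
  "local_consequence S \<Gamma> A \<longleftrightarrow>
     (if \<Gamma> = {} then valid S A
      else \<forall>S'. extends S' S \<longrightarrow> (\<forall>B\<in>\<Gamma>. valid S' B) \<longrightarrow> valid S' A)"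

definition global_consequence :: "'a atomic_system \<Rightarrow> 'a form set \<Rightarrow> 'a form \<Rightarrow> bool" where
  "global_consequence S \<Gamma> A \<longleftrightarrow>
     (\<forall>S'. extends S' S \<longrightarrow>
        (\<forall>B\<in>\<Gamma>. \<forall>S''. extends S'' S' \<longrightarrow> valid S'' B) \<longrightarrow>
        (\<forall>S''. extends S'' S' \<longrightarrow> valid S'' A))"

lemma valid_classical_iff:
  "valid S (Compound k A B Clas) \<longleftrightarrow>
     \<not> local_consequence S {Compound k A B Intu} (Atomic Falsum Intu)"
  by (simp add: local_consequence_def)

lemma valid_Imp_iff:
  "valid S (Compound Imp A B Intu) \<longleftrightarrow> global_consequence S {A} B"
  by (simp add: global_consequence_def)

lemma valid_Disj_iff:
  "valid S (Compound Disj A B Intu) \<longleftrightarrow>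
     (\<forall>S' p. extends S' S \<longrightarrow>
        local_consequence S' {A} (Atomic p Intu) \<longrightarrow>
        local_consequence S' {B} (Atomic p Intu) \<longrightarrow>
        local_consequence S' {} (Atomic p Intu))"
  by (simp add: local_consequence_def)

end

theory Submission
  imports Defs
begin

text \<open>The classical formula only denies that the intuitionistic one locally entails falsum. An
  extension where the latter is valid refutes that entailment by itself: it extends itself and,
  being consistent, does not validate falsum.\<close>

lemma extends_imp_self_extends: "extends S' S \<Longrightarrow> extends S' S'"
  by (simp add: extends_def)

lemma extends_imp_not_valid_Falsum: "extends S' S \<Longrightarrow> \<not> valid S' (Atomic Falsum Intu)"
  by (simp add: extends_def consistent_def)

theorem theorem2:
  fixes S :: "'a::{countable, infinite} atomic_system"
    and k :: conn and B C :: "'a form"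
  assumes "consistent S"
  shows "local_consequence S {Compound k B C Intu} (Compound k B C Clas)"
proof -
  have "valid S' (Compound k B C Clas)"
    if "extends S' S" and "valid S' (Compound k B C Intu)" for S'
    \<comment> \<open>Only the classical clause is unfolded: \<open>Compound k B C Intu\<close>
      stays opaque, so all \<open>k\<close> are treated alike. The witness is \<open>S'\<close>
      itself.\<close>
    unfolding valid.simps(3)
    using that extends_imp_self_extends extends_imp_not_valid_Falsum by blast
  then show ?thesis
    by (simp add: local_consequence_def del: valid.simps)
qed

end
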